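(* Let $D$ be an almost Dedekind domain and let $I$ be a nonzero proper finitely generated ideal of $D$. Then the function $\nu_I$ is lower semicontinuous with respect to the constructible topology on $\mathrm{Max}(D)$; that is, for every integer $n\geq 0$ the set $\{M\in\mathrm{Max}(D)\mid v_M(I)\leq n\}$ is closed (equivalently, $\{M\in\mathrm{Max}(D)\mid v_M(I)>n\}$ is open).
   Context: An almost Dedekind domain is an integral domain $D$ such that $D_M$ is a discrete valuation ring for every maximal ideal $M$ of $D$. For a nonzero ideal $I$, $\nu_I:\mathrm{Max}(D)\to\mathbb{Z}$ is defined by $\nu_I(M):=v_M(I)$, where $v_M$ is the valuation of $D_M$. The constructible topology on $\mathrm{Max}(D)$ is the topology generated by the sets $\{M\in\mathrm{Max}(D)\mid J\subseteq M\}$ and $\{M\in\mathrm{Max}(D)\mid J\nsubseteq M\}$ as $J$ ranges among the finitely generated ideals of $D$. *)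

theory Defs
  imports "HOL-Analysis.Analysis" "HOL-Algebra.Ring_Divisibility"
begin

definition finitely_generated_ideal :: "('a, 'b) ring_scheme \<Rightarrow> 'a set \<Rightarrow> bool" where
  "finitely_generated_ideal R I \<longleftrightarrow> (\<exists>A. finite A \<and> A \<subseteq> carrier R \<and> I = Idl\<^bsub>R\<^esub> A)"

definition Max_spec :: "('a, 'b) ring_scheme \<Rightarrow> 'a set set" where
  "Max_spec R = {M. maximalideal M R}"

text \<open>
  The ring of fractions \<open>S\<^sup>-\<^sup>1R\<close> of a commutative ring with respect to a multiplicative set \<open>S\<close>.
  Its elements are equivalence classes of pairs \<open>(a, s)\<close>, read as \<open>a / s\<close>.
\<close>

definition frac_rel ::
    "('a, 'b) ring_scheme \<Rightarrow> 'a set \<Rightarrow> (('a \<times> 'a) \<times> ('a \<times> 'a)) set" where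
  "frac_rel R S = {((a, s), (b, t)). a \<in> carrier R \<and> s \<in> S \<and> b \<in> carrier R \<and> t \<in> S \<and>
     (\<exists>u\<in>S. u \<otimes>\<^bsub>R\<^esub> (a \<otimes>\<^bsub>R\<^esub> t) = u \<otimes>\<^bsub>R\<^esub> (b \<otimes>\<^bsub>R\<^esub> s))}"

definition mk_frac :: "('a, 'b) ring_scheme \<Rightarrow> 'a set \<Rightarrow> 'a \<Rightarrow> 'a \<Rightarrow> ('a \<times> 'a) set" where
  "mk_frac R S a s = frac_rel R S `` {(a, s)}"

definition ring_of_fractions :: "('a, 'b) ring_scheme \<Rightarrow> 'a set \<Rightarrow> ('a \<times> 'a) set ring" where
  "ring_of_fractions R S =
     \<lparr>carrier = (carrier R \<times> S) // frac_rel R S,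
      monoid.mult = (\<lambda>A B. \<Union>(a, s)\<in>A. \<Union>(b, t)\<in>B. mk_frac R S (a \<otimes>\<^bsub>R\<^esub> b) (s \<otimes>\<^bsub>R\<^esub> t)),
      one = mk_frac R S \<one>\<^bsub>R\<^esub> \<one>\<^bsub>R\<^esub>,
      ring.zero = mk_frac R S \<zero>\<^bsub>R\<^esub> \<one>\<^bsub>R\<^esub>,
      ring.add = (\<lambda>A B. \<Union>(a, s)\<in>A. \<Union>(b, t)\<in>B.
               mk_frac R S (a \<otimes>\<^bsub>R\<^esub> t \<oplus>\<^bsub>R\<^esub> b \<otimes>\<^bsub>R\<^esub> s) (s \<otimes>\<^bsub>R\<^esub> t))\<rparr>"

definition localization_at :: "('a, 'b) ring_scheme \<Rightarrow> 'a set \<Rightarrow> ('a \<times> 'a) set ring" where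
  "localization_at R P = ring_of_fractions R (carrier R - P)"

definition discrete_valuation_ring :: "('a, 'b) ring_scheme \<Rightarrow> bool" where
  "discrete_valuation_ring R \<longleftrightarrow>
     principal_domain R \<and> \<not> field R \<and> (\<exists>!m. maximalideal m R)"

definition uniformizer :: "('a, 'b) ring_scheme \<Rightarrow> 'a \<Rightarrow> bool" where
  "uniformizer R p \<longleftrightarrow> p \<in> carrier R \<and> maximalideal (PIdl\<^bsub>R\<^esub> p) R"

text \<open>
  The normalized valuation of a discrete valuation ring, on nonzero elements of the ring
  (where it is nonnegative): \<open>x = u p\<^sup>n\<close> with \<open>u\<close> a unit and \<open>p\<close> a uniformizer.
  The value at zero is unspecified.
\<close>

definition dvr_valuation :: "('a, 'b) ring_scheme \<Rightarrow> 'a \<Rightarrow> int" where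
  "dvr_valuation R x =
     int (THE n::nat. \<exists>p u. uniformizer R p \<and> u \<in> Units R \<and> x = u \<otimes>\<^bsub>R\<^esub> p [^]\<^bsub>R\<^esub> n)"

definition almost_dedekind_domain :: "('a, 'b) ring_scheme \<Rightarrow> bool" where
  "almost_dedekind_domain D \<longleftrightarrow>
     domain D \<and> (\<forall>M\<in>Max_spec D. discrete_valuation_ring (localization_at D M))"

definition val_at :: "('a, 'b) ring_scheme \<Rightarrow> 'a set \<Rightarrow> 'a \<Rightarrow> int" where
  "val_at D M x = dvr_valuation (localization_at D M) (mk_frac D (carrier D - M) x \<one>\<^bsub>D\<^esub>)"

text \<open>
  \<open>v\<^sub>M(I)\<close> is the minimum of \<open>v\<^sub>M(x)\<close> over \<open>x \<in> I\<close>; as \<open>v\<^sub>M(0) = \<infinity>\<close>, zero is left out.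
  Values are nonnegative, so the integer infimum is attained for every nonzero \<open>I\<close>.
\<close>

definition ideal_val :: "('a, 'b) ring_scheme \<Rightarrow> 'a set \<Rightarrow> 'a set \<Rightarrow> int" where
  "ideal_val D I M = (INF x\<in>I - {\<zero>\<^bsub>D\<^esub>}. val_at D M x)"

definition constructible_topology :: "('a, 'b) ring_scheme \<Rightarrow> 'a set topology" where
  "constructible_topology D = topology_generated_by
     ({{M \<in> Max_spec D. J \<subseteq> M} | J. finitely_generated_ideal D J} \<union>
      {{M \<in> Max_spec D. \<not> J \<subseteq> M} | J. finitely_generated_ideal D J})"

definition lower_semicontinuous_map :: "'a topology \<Rightarrow> ('a \<Rightarrow> 'b::linorder) \<Rightarrow> bool" where
  "lower_semicontinuous_map T f \<longleftrightarrow> (\<forall>c. openin T {x \<in> topspace T. f x > c})"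

end

theory Submission
  imports Defs
begin

text \<open>The values are nonnegative integers, so a strict bound \<open>n < v\<close> is the same
  as \<open>n + 1 \<le> v\<close>, and it suffices that the sets where
  \<open>int k \<le> ideal_val D I M\<close> are open (\<open>openin_ideal_val_ge\<close>).

  The point is that such a bound at one \<open>M\<close> is witnessed by an equation in
  \<open>D\<close>. Choose \<open>a\<close> in \<open>M\<close> whose image generates the maximal
  ideal of the localization. By \<open>dvr_valuation_ge_iff\<close> and clearing of denominators
  (\<open>val_at_ge_imp_divides\<close>), every nonzero generator \<open>x\<close> of
  \<open>I\<close> has a multiple \<open>s \<otimes> x\<close> divisible by \<open>a [^] k\<close>,
  with \<open>s\<close> outside \<open>M\<close>. Finitely many generators admit a common
  \<open>s\<close> (\<open>finite_common_multiplier\<close>), and this \<open>s\<close> then works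
  for all of \<open>I\<close> (\<open>genideal_multiplier\<close>).

  The divisibility no longer mentions \<open>M\<close>. At any maximal ideal \<open>N\<close>
  containing \<open>a\<close> but not \<open>s\<close>, the image of \<open>s\<close> is a unit and
  that of \<open>a\<close> is a nonunit, so every nonzero element of \<open>I\<close> has value at
  least \<open>k\<close> there (\<open>divides_imp_val_at_ge\<close>). These two conditions on
  \<open>N\<close> cut out a neighbourhood of \<open>M\<close>, the intersection of one generating
  set of each kind.\<close>

section \<open>Valuations of discrete valuation rings\<close>

lemma (in comm_monoid) divides_pow:
  assumes "a \<in> carrier G" "a divides b"
  shows "a [^] (k::nat) divides b [^] k"
  using assms nat_pow_distrib by (fastforce simp: factor_def)

locale dvr =
  fixes R :: "('a, 'b) ring_scheme" (structure)
  assumes dvr: "discrete_valuation_ring R"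

sublocale dvr \<subseteq> principal_domain R
  using dvr by (simp add: discrete_valuation_ring_def)

context dvr
begin

lemma uniformizer_exists: "\<exists>p. uniformizer R p"
proof -
  obtain m where m: "maximalideal m R"
    using dvr by (auto simp: discrete_valuation_ring_def)
  then have "ideal m R" by (rule maximalideal.axioms)
  then show ?thesis
    using exists_gen m by (auto simp: uniformizer_def)
qed

lemma uniformizer_closed: "uniformizer R p \<Longrightarrow> p \<in> carrier R"
  by (simp add: uniformizer_def)

text \<open>Otherwise the zero ideal would be maximal and the ring a field, which the definition of
  a discrete valuation ring excludes.\<close>

lemma uniformizer_not_zero:
  assumes "uniformizer R p"
  shows "p \<noteq> \<zero>"
proof
  assume "p = \<zero>"
  then have "maximalideal {\<zero>} R"
    using assms cgenideal_eq_genideal[of \<zero>] genideal_zero by (simp add: uniformizer_def)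
  then show False
    using dvr zeromaximalideal_eq_field by (simp add: discrete_valuation_ring_def)
qed

lemma uniformizer_not_unit:
  assumes "uniformizer R p"
  shows "p \<notin> Units R"
  using assms ideal_eq_carrier_iff[of p] maximalideal.I_notcarr
  by (fastforce simp: uniformizer_def)

lemma maximalideal_unique:
  "maximalideal m R \<Longrightarrow> maximalideal m' R \<Longrightarrow> m = m'"
  using dvr by (auto simp: discrete_valuation_ring_def)

lemma uniformizer_associated:
  assumes "uniformizer R p" "uniformizer R q"
  shows "p \<sim> q"
  using assms associated_iff_same_ideal maximalideal_unique by (auto simp: uniformizer_def)

lemma uniformizer_pow_not_zero:
  "uniformizer R p \<Longrightarrow> p [^] (n::nat) \<noteq> \<zero>"
  by (induction n) (simp_all add: integral_iff uniformizer_closed uniformizer_not_zero)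

text \<open>In a principal domain an irreducible element generates a maximal ideal. There is only
  one such ideal here, so each irreducible factor is itself a uniformizer, hence a unit times
  \<open>p\<close>; the units are collected in front.\<close>

lemma foldr_irreducibles_eq_uniformizer_pow:
  assumes p: "uniformizer R p"
    and "set fs \<subseteq> carrier (mult_of R)" "\<forall>f\<in>set fs. irreducible (mult_of R) f"
  shows "\<exists>u\<in>Units R. foldr (\<otimes>) fs \<one> = u \<otimes> p [^] length fs"
  using assms(2,3)
proof (induction fs)
  case Nil
  then show ?case by force
next
  case (Cons f fs)
  then obtain u where u: "u \<in> Units R" "foldr (\<otimes>) fs \<one> = u \<otimes> p [^] length fs"
    by auto
  have "f \<in> carrier R" "ring_irreducible f"
    using Cons.prems ring_irreducibleI'[of f] by auto
  then have "uniformizer R f"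
    by (simp add: uniformizer_def irreducible_imp_maximalideal)
  then obtain w where w: "w \<in> Units R" "f = w \<otimes> p"
    using uniformizer_associated[of f p] p ring_associated_iff uniformizer_closed by metis
  have "foldr (\<otimes>) (f # fs) \<one> = (w \<otimes> u) \<otimes> p [^] length (f # fs)"
    using u w uniformizer_closed[OF p] by (simp add: Units_closed m_ac)
  then show ?case
    using u w Units_m_closed by blast
qed

lemma uniformizer_decomposition:
  assumes p: "uniformizer R p" and x: "x \<in> carrier R" "x \<noteq> \<zero>"
  shows "\<exists>u\<in>Units R. \<exists>n::nat. x = u \<otimes> p [^] n"
proof -
  obtain fs where fs: "set fs \<subseteq> carrier (mult_of R)" "wfactors (mult_of R) fs x"
    using mult_of.wfactors_exist[of x] x by auto
  obtain u where u: "u \<in> Units R" "foldr (\<otimes>) fs \<one> = u \<otimes> p [^] length fs"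
    using foldr_irreducibles_eq_uniformizer_pow[OF p fs(1)] fs(2) by (auto simp: wfactors_def)
  have up: "u \<otimes> p [^] length fs \<in> carrier R"
    using u uniformizer_closed[OF p] by (simp add: Units_closed)
  \<comment> \<open>\<open>wfactors\<close> gives the product of the factors only up to association,
    whence the second unit \<open>w\<close> below.\<close>
  have "u \<otimes> p [^] length fs \<sim> x"
    using fs(2) u(2) assoc_iff_assoc_mult[OF up x(1)] by (simp add: wfactors_def)
  then have "x \<sim> u \<otimes> p [^] length fs"
    by (simp add: associated_def)
  then obtain w where w: "w \<in> Units R" "x = w \<otimes> (u \<otimes> p [^] length fs)"
    using ring_associated_iff up x(1) by blast
  then have "x = (w \<otimes> u) \<otimes> p [^] length fs"
    using u uniformizer_closed[OF p] by (simp add: Units_closed m_assoc)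
  then show ?thesis
    using u w Units_m_closed by blast
qed

text \<open>Two uniformizers are allowed because \<open>dvr_valuation\<close> lets the uniformizer
  vary with the exponent. Writing \<open>q = w \<otimes> p\<close> moves \<open>w [^] n\<close> into
  the unit part and leaves a single uniformizer.\<close>

lemma uniformizer_pow_divides_iff:
  assumes p: "uniformizer R p" and q: "uniformizer R q" and u: "u \<in> Units R"
  shows "p [^] (k::nat) divides u \<otimes> q [^] (n::nat) \<longleftrightarrow> k \<le> n"
proof -
  obtain w where w: "w \<in> Units R" "q = w \<otimes> p"
    using uniformizer_associated[OF q p] p q ring_associated_iff uniformizer_closed by metis
  have pc: "p \<in> carrier R" and wc: "w \<in> carrier R" and uc: "u \<in> carrier R"
    using p w u by (auto simp: uniformizer_closed)
  define e where "e = u \<otimes> w [^] n"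
  have e: "e \<in> Units R" "e \<in> carrier R"
    using u w uc wc by (auto simp: e_def Units_pow_closed)
  have eq: "u \<otimes> q [^] n = e \<otimes> p [^] n"
    using w(2) pc wc uc by (simp add: e_def nat_pow_distrib m_assoc)
  show ?thesis
  proof
    assume "k \<le> n"
    then have "e \<otimes> p [^] n = p [^] k \<otimes> (e \<otimes> p [^] (n - k))"
      using pc e by (metis le_add_diff_inverse m_lcomm nat_pow_closed nat_pow_mult)
    then show "p [^] k divides u \<otimes> q [^] n"
      unfolding factor_def eq using pc e by blast
  next
    assume "p [^] k divides u \<otimes> q [^] n"
    then obtain c where c: "c \<in> carrier R" "e \<otimes> p [^] n = p [^] k \<otimes> c"
      by (auto simp: factor_def eq)
    show "k \<le> n"
    \<comment> \<open>If \<open>k\<close> exceeds \<open>n\<close>, cancelling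
      \<open>p [^] n\<close> leaves \<open>p\<close> as a factor of the unit \<open>e\<close>, so
      \<open>p\<close> would be a unit.\<close>
    proof (rule ccontr)
      assume "\<not> k \<le> n"
      then obtain j where "k = n + Suc j"
        using less_iff_Suc_add[of n k] by auto
      then have "p [^] k = p [^] n \<otimes> (p [^] j \<otimes> p)"
        using pc by (simp flip: nat_pow_mult add: m_assoc)
      then have "p [^] n \<otimes> e = p [^] n \<otimes> (p [^] j \<otimes> p \<otimes> c)"
        using c pc e by (simp add: m_ac)
      then have "e = p [^] j \<otimes> p \<otimes> c"
        using uniformizer_pow_not_zero[OF p] pc c e m_lcancel by simp
      then have "e = p \<otimes> (p [^] j \<otimes> c)"
        using pc c by (simp add: m_ac)
      then have "p \<in> Units R"
        using e pc c by (metis m_closed nat_pow_closed unit_factor)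
      then show False
        using uniformizer_not_unit[OF p] by simp
    qed
  qed
qed

lemma dvr_valuation_unit_times_pow:
  assumes p: "uniformizer R p" and u: "u \<in> Units R"
  shows "dvr_valuation R (u \<otimes> p [^] (n::nat)) = int n"
proof -
  \<comment> \<open>Both exponents equal the largest power of \<open>p\<close> dividing the common
    element, so the description under \<open>THE\<close> is unique.\<close>
  have "m = n" if q: "uniformizer R q" and w: "w \<in> Units R" and eq: "u \<otimes> p [^] n = w \<otimes> q [^] m"
    for q w and m :: nat
    using uniformizer_pow_divides_iff[OF p p u, where n = n]
      uniformizer_pow_divides_iff[OF p q w, where n = m] eq
    by (metis order_antisym order_refl)
  then have "(THE m::nat. \<exists>q w. uniformizer R q \<and> w \<in> Units R \<and> u \<otimes> p [^] n = w \<otimes> q [^] m) = n"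
    using p u by (intro the_equality) auto
  then show ?thesis
    by (simp add: dvr_valuation_def)
qed

text \<open>This replaces the valuation by divisibility; the later arguments compare values only
  through it.\<close>

lemma dvr_valuation_ge_iff:
  assumes p: "uniformizer R p" and x: "x \<in> carrier R" "x \<noteq> \<zero>"
  shows "int k \<le> dvr_valuation R x \<longleftrightarrow> p [^] k divides x"
proof -
  obtain u n where u: "u \<in> Units R" and x: "x = u \<otimes> p [^] (n::nat)"
    using uniformizer_decomposition[OF assms] by blast
  show ?thesis
    unfolding x dvr_valuation_unit_times_pow[OF p u] uniformizer_pow_divides_iff[OF p p u] by simp
qed

text \<open>The exponent of a nonzero nonunit cannot be 0. This serves at the maximal ideals
  \<open>N\<close> near \<open>M\<close>, where \<open>a\<close> is known to be a nonunit but may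
  fail to be a uniformizer.\<close>

lemma uniformizer_divides_nonunit:
  assumes p: "uniformizer R p" and x: "x \<in> carrier R" "x \<notin> Units R"
  shows "p divides x"
proof (cases "x = \<zero>")
  case True
  then show ?thesis
    using p divides_zero uniformizer_closed by simp
next
  case False
  then obtain u n where u: "u \<in> Units R" and x': "x = u \<otimes> p [^] (n::nat)"
    using uniformizer_decomposition[OF p x(1)] by blast
  have "n \<noteq> 0"
    using x(2) x' u by (auto intro: ccontr)
  then show ?thesis
    using uniformizer_pow_divides_iff[OF p p u, of 1 n] uniformizer_closed[OF p]
    by (simp add: x' Units_closed)
qed

end

section \<open>Localization of a domain at a maximal ideal\<close>

locale localized_domain = domain D for D :: "('a, 'b) ring_scheme" (structure) +
  fixes M
  assumes maximal: "maximalideal M D"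
begin

abbreviation S where "S \<equiv> carrier D - M"
abbreviation L where "L \<equiv> localization_at D M"
abbreviation frac where "frac \<equiv> mk_frac D S"

sublocale M: maximalideal M D
  by (rule maximal)

sublocale M: primeideal M D
  using maximalideal_prime maximal by blast

lemma one_mem_S: "\<one> \<in> S"
  using M.one_imp_carrier M.I_notcarr by auto

lemma S_mult_closed: "s \<in> S \<Longrightarrow> t \<in> S \<Longrightarrow> s \<otimes> t \<in> S"
  using M.I_prime by auto

lemma S_not_zero: "s \<in> S \<Longrightarrow> s \<noteq> \<zero>"
  using M.zero_closed by auto

text \<open>In a domain the auxiliary factor \<open>u\<close> of \<open>frac_rel\<close> is nonzero
  and cancels, which leaves plain cross multiplication.\<close>

lemma frac_rel_iff:
  "((a, s), (b, t)) \<in> frac_rel D S \<longleftrightarrow>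
     a \<in> carrier D \<and> s \<in> S \<and> b \<in> carrier D \<and> t \<in> S \<and> a \<otimes> t = b \<otimes> s"
  using one_mem_S S_not_zero by (auto simp: frac_rel_def m_lcancel)

lemma equiv_frac_rel: "equiv (carrier D \<times> S) (frac_rel D S)"
proof (rule equivI)
  show "frac_rel D S \<subseteq> (carrier D \<times> S) \<times> carrier D \<times> S"
    by (auto simp: frac_rel_iff)
  show "refl_on (carrier D \<times> S) (frac_rel D S)"
    by (auto simp: refl_on_def frac_rel_iff)
  show "sym (frac_rel D S)"
    by (auto simp: sym_def frac_rel_iff)
  show "trans (frac_rel D S)"
  proof (rule transI, clarify)
    fix a s b t c r
    assume "((a, s), (b, t)) \<in> frac_rel D S" "((b, t), (c, r)) \<in> frac_rel D S"
    then have car: "a \<in> carrier D" "b \<in> carrier D" "c \<in> carrier D" "s \<in> S" "t \<in> S" "r \<in> S"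
      and eqs: "a \<otimes> t = b \<otimes> s" "b \<otimes> r = c \<otimes> t"
      by (auto simp: frac_rel_iff)
    \<comment> \<open>Transitivity: the two equations are linked after multiplying by the middle
      denominator \<open>t\<close>, which is nonzero and is cancelled at the end.\<close>
    have "t \<otimes> (a \<otimes> r) = (a \<otimes> t) \<otimes> r"
      using car by (simp add: m_ac)
    also have "\<dots> = s \<otimes> (b \<otimes> r)"
      unfolding eqs(1) using car by (simp add: m_ac)
    also have "\<dots> = t \<otimes> (c \<otimes> s)"
      unfolding eqs(2) using car by (simp add: m_ac)
    finally have "a \<otimes> r = c \<otimes> s"
      using car S_not_zero by (simp add: m_lcancel)
    then show "((a, s), (c, r)) \<in> frac_rel D S"
      using car by (simp add: frac_rel_iff)
  qed
qed

lemma frac_eq_iff: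
  assumes "a \<in> carrier D" "s \<in> S" "b \<in> carrier D" "t \<in> S"
  shows "frac a s = frac b t \<longleftrightarrow> a \<otimes> t = b \<otimes> s"
  using eq_equiv_class_iff[OF equiv_frac_rel, of "(a, s)" "(b, t)"] assms
  by (simp add: mk_frac_def frac_rel_iff)

lemma frac_closed: "a \<in> carrier D \<Longrightarrow> s \<in> S \<Longrightarrow> frac a s \<in> carrier L"
  by (simp add: localization_at_def ring_of_fractions_def mk_frac_def quotientI)

lemma carrier_localizationE:
  assumes "x \<in> carrier L"
  obtains a s where "a \<in> carrier D" "s \<in> S" "x = frac a s"
  using assms unfolding localization_at_def ring_of_fractions_def mk_frac_def
  by (auto elim!: quotientE)

lemma mem_frac_iff:
  assumes "a \<in> carrier D" "s \<in> S"
  shows "(b, t) \<in> frac a s \<longleftrightarrow> b \<in> carrier D \<and> t \<in> S \<and> a \<otimes> t = b \<otimes> s"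
  using assms by (auto simp: mk_frac_def frac_rel_iff)

lemma frac_mult:
  assumes "a \<in> carrier D" "s \<in> S" "b \<in> carrier D" "t \<in> S"
  shows "frac a s \<otimes>\<^bsub>L\<^esub> frac b t = frac (a \<otimes> b) (s \<otimes> t)"
proof -
  \<comment> \<open>Independence of representatives: all members of the union that defines the
    product are the same class.\<close>
  have eq: "frac (a' \<otimes> b') (s' \<otimes> t') = frac (a \<otimes> b) (s \<otimes> t)"
    if "(a', s') \<in> frac a s" "(b', t') \<in> frac b t" for a' s' b' t'
  proof -
    have car: "a' \<in> carrier D" "s' \<in> S" "b' \<in> carrier D" "t' \<in> S"
      and eqs: "a \<otimes> s' = a' \<otimes> s" "b \<otimes> t' = b' \<otimes> t"
      using that assms by (auto simp: mem_frac_iff)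
    have "(a' \<otimes> b') \<otimes> (s \<otimes> t) = (a' \<otimes> s) \<otimes> (b' \<otimes> t)"
      using car assms by (simp add: m_ac)
    also have "\<dots> = (a \<otimes> b) \<otimes> (s' \<otimes> t')"
      unfolding eqs[symmetric] using car assms by (simp add: m_ac)
    finally show ?thesis
      using car assms S_mult_closed by (subst frac_eq_iff) auto
  qed
  have "(a, s) \<in> frac a s" "(b, t) \<in> frac b t"
    using assms by (simp_all add: mem_frac_iff)
  then have "(\<Union>(a', s')\<in>frac a s. \<Union>(b', t')\<in>frac b t. frac (a' \<otimes> b') (s' \<otimes> t'))
      = frac (a \<otimes> b) (s \<otimes> t)"
    using eq by fast
  then show ?thesis
    by (simp add: localization_at_def ring_of_fractions_def)
qed

lemma frac_one: "frac \<one> \<one> = \<one>\<^bsub>L\<^esub>"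
  by (simp add: localization_at_def ring_of_fractions_def)

lemma frac_zero: "frac \<zero> \<one> = \<zero>\<^bsub>L\<^esub>"
  by (simp add: localization_at_def ring_of_fractions_def)

lemma frac_eq_zero_iff: "a \<in> carrier D \<Longrightarrow> frac a \<one> = \<zero>\<^bsub>L\<^esub> \<longleftrightarrow> a = \<zero>"
  using frac_eq_iff[of a \<one> \<zero> \<one>] one_mem_S by (simp flip: frac_zero)

lemma frac_pow:
  assumes "a \<in> carrier D"
  shows "frac a \<one> [^]\<^bsub>L\<^esub> (n::nat) = frac (a [^] n) \<one>"
proof (induction n)
  case 0
  show ?case by (simp add: frac_one nat_pow_def)
next
  case (Suc n)
  have "frac a \<one> [^]\<^bsub>L\<^esub> Suc n = frac a \<one> [^]\<^bsub>L\<^esub> n \<otimes>\<^bsub>L\<^esub> frac a \<one>"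
    by (simp add: nat_pow_def)
  then show ?case
    using Suc frac_mult[of "a [^] n" \<one> a \<one>] assms one_mem_S by simp
qed

lemma frac_mult_inverse:
  assumes "s \<in> S"
  shows "frac s \<one> \<otimes>\<^bsub>L\<^esub> frac \<one> s = \<one>\<^bsub>L\<^esub>" "frac \<one> s \<otimes>\<^bsub>L\<^esub> frac s \<one> = \<one>\<^bsub>L\<^esub>"
  using frac_mult[of s \<one> \<one> s] frac_mult[of \<one> s s \<one>] frac_eq_iff[of s s \<one> \<one>] assms one_mem_S
  by (auto simp: frac_one)

lemma frac_unit: "s \<in> S \<Longrightarrow> frac s \<one> \<in> Units L"
  using frac_closed one_mem_S frac_mult_inverse unfolding Units_def by blast

text \<open>An inverse \<open>frac b t\<close> would give \<open>a \<otimes> b = t\<close>, an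
  element both inside and outside \<open>M\<close>.\<close>

lemma frac_nonunit:
  assumes "a \<in> M"
  shows "frac a \<one> \<notin> Units L"
proof
  assume "frac a \<one> \<in> Units L"
  then obtain y where "y \<in> carrier L" "frac a \<one> \<otimes>\<^bsub>L\<^esub> y = \<one>\<^bsub>L\<^esub>"
    by (auto simp: Units_def)
  then obtain b t where bt: "b \<in> carrier D" "t \<in> S" "frac a \<one> \<otimes>\<^bsub>L\<^esub> frac b t = \<one>\<^bsub>L\<^esub>"
    by (metis carrier_localizationE)
  then have "a \<otimes> b = t"
    using frac_mult[of a \<one> b t] frac_eq_iff[of "a \<otimes> b" t \<one> \<one>] assms M.Icarr one_mem_S
    by (simp flip: frac_one)
  moreover have "a \<otimes> b \<in> M"
    using assms bt(1) by (rule M.I_r_closed)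
  ultimately show False
    using bt(2) by simp
qed

text \<open>The product of the individual multipliers works, since \<open>S\<close> is closed under
  multiplication. Finite generation of the ideal enters the argument here.\<close>

lemma finite_common_multiplier:
  assumes "finite A" "A \<subseteq> carrier D" "c \<in> carrier D"
    and "\<And>x. x \<in> A \<Longrightarrow> \<exists>s\<in>S. c divides s \<otimes> x"
  shows "\<exists>s\<in>S. \<forall>x\<in>A. c divides s \<otimes> x"
  using assms(1,2,4)
proof (induction A)
  case empty
  then show ?case using one_mem_S by blast
next
  case (insert y A)
  then obtain s where s: "s \<in> S" "\<forall>x\<in>A. c divides s \<otimes> x" by auto
  obtain t where t: "t \<in> S" "c divides t \<otimes> y" using insert.prems by blast
  have mult: "c divides u \<otimes> v" if "c divides v" "u \<in> carrier D" for u v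
    using that assms(3) m_lcomm[of u c] unfolding factor_def by (metis m_closed)
  have "c divides (t \<otimes> s) \<otimes> x" if "x \<in> A" for x
    using mult[of "s \<otimes> x" t] s t that insert.prems by (auto simp: m_assoc)
  moreover have "c divides (t \<otimes> s) \<otimes> y"
    using mult[of "t \<otimes> y" s] s t insert.prems by (auto simp: m_ac)
  ultimately show ?case
    using S_mult_closed s t by blast
qed

end

section \<open>Valuation bounds at a maximal ideal as divisibility in the domain\<close>

locale dvr_localized_domain = localized_domain +
  assumes dvr_localization: "discrete_valuation_ring L"

sublocale dvr_localized_domain \<subseteq> L: dvr L
  by (simp add: dvr_def dvr_localization)

context dvr_localized_domain
begin

text \<open>Denominators are units of the localization, so the numerator of any uniformizer is again
  one; it lies in \<open>M\<close> because otherwise its image would be a unit.\<close>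

lemma frac_uniformizer_exists: "\<exists>a\<in>M. uniformizer L (frac a \<one>)"
proof -
  obtain p where p: "uniformizer L p"
    using L.uniformizer_exists by blast
  then obtain a s where a: "a \<in> carrier D" "s \<in> S" "p = frac a s"
    using L.uniformizer_closed carrier_localizationE by metis
  have "frac a \<one> = frac s \<one> \<otimes>\<^bsub>L\<^esub> p"
    using frac_mult[of s \<one> a s] frac_eq_iff[of a \<one> "s \<otimes> a" s] a one_mem_S by (simp add: m_comm)
  then have "frac a \<one> \<sim>\<^bsub>L\<^esub> p"
    using L.ring_associated_iff[of "frac a \<one>" p] frac_unit a one_mem_S frac_closed by blast
  then have u: "uniformizer L (frac a \<one>)"
    using p L.associated_iff_same_ideal[of "frac a \<one>" p] frac_closed a one_mem_S
    by (simp add: uniformizer_def)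
  have "a \<in> M"
    using L.uniformizer_not_unit[OF u] frac_unit a(1) by blast
  with u show ?thesis by blast
qed

lemma val_at_ge_imp_divides:
  assumes a: "a \<in> carrier D" "uniformizer L (frac a \<one>)"
    and x: "x \<in> carrier D" "x \<noteq> \<zero>" "int k \<le> val_at D M x"
  shows "\<exists>s\<in>S. a [^] k divides s \<otimes> x"
proof -
  have "frac (a [^] k) \<one> divides\<^bsub>L\<^esub> frac x \<one>"
    using L.dvr_valuation_ge_iff[OF a(2), of "frac x \<one>" k] x frac_closed frac_eq_zero_iff
      one_mem_S frac_pow[OF a(1), of k] by (simp add: val_at_def)
  then obtain b t where bt: "b \<in> carrier D" "t \<in> S"
    "frac x \<one> = frac (a [^] k) \<one> \<otimes>\<^bsub>L\<^esub> frac b t"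
    unfolding factor_def by (metis carrier_localizationE)
  then have "t \<otimes> x = a [^] k \<otimes> b"
    using frac_mult[of "a [^] k" \<one> b t] frac_eq_iff[of x \<one> "a [^] k \<otimes> b" t] a x one_mem_S
    by (simp add: m_comm)
  then show ?thesis
    using bt by (auto simp: factor_def)
qed

text \<open>Unlike in \<open>val_at_ge_imp_divides\<close>, \<open>a\<close> need only lie in
  \<open>M\<close>: its image is then divisible by a uniformizer, so its \<open>k\<close>-th power
  has value at least \<open>k\<close>. This weaker demand lets a bound spread from one maximal ideal
  to others.\<close>

lemma divides_imp_val_at_ge:
  assumes a: "a \<in> M" and s: "s \<in> S" and x: "x \<in> carrier D" "x \<noteq> \<zero>"
    and dvd: "a [^] k divides s \<otimes> x"
  shows "int k \<le> val_at D M x"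
proof -
  obtain p where p: "uniformizer L p"
    using L.uniformizer_exists by blast
  note pc = L.uniformizer_closed[OF p]
  have ac: "a \<in> carrier D" using a by (rule M.Icarr)
  have fc: "frac a \<one> \<in> carrier L" "frac x \<one> \<in> carrier L" "frac s \<one> \<in> Units L"
    using ac x s frac_closed one_mem_S frac_unit by auto
  obtain z where z: "z \<in> carrier D" "s \<otimes> x = a [^] k \<otimes> z"
    using dvd by (auto simp: factor_def)
  have "frac s \<one> \<otimes>\<^bsub>L\<^esub> frac x \<one> = frac a \<one> [^]\<^bsub>L\<^esub> k \<otimes>\<^bsub>L\<^esub> frac z \<one>"
    using frac_mult[of s \<one> x \<one>] frac_mult[of "a [^] k" \<one> z \<one>] frac_pow[OF ac] z x s ac one_mem_S
    by simp
  then have 1: "frac a \<one> [^]\<^bsub>L\<^esub> k divides\<^bsub>L\<^esub> frac s \<one> \<otimes>\<^bsub>L\<^esub> frac x \<one>"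
    using frac_closed z one_mem_S by (auto simp: factor_def)
  \<comment> \<open>As \<open>s\<close> lies outside \<open>M\<close>, its image is a unit, and
    multiplying by it only changes \<open>frac x \<one>\<close> to an associate.\<close>
  have 2: "frac s \<one> \<otimes>\<^bsub>L\<^esub> frac x \<one> divides\<^bsub>L\<^esub> frac x \<one>"
    using L.ring_associated_iff[of "frac s \<one> \<otimes>\<^bsub>L\<^esub> frac x \<one>" "frac x \<one>"]
      fc L.Units_closed[OF fc(3)] L.m_closed unfolding associated_def by blast
  have 3: "p [^]\<^bsub>L\<^esub> k divides\<^bsub>L\<^esub> frac a \<one> [^]\<^bsub>L\<^esub> k"
    by (intro L.divides_pow L.uniformizer_divides_nonunit[OF p] fc pc frac_nonunit[OF a])
  have "p [^]\<^bsub>L\<^esub> k divides\<^bsub>L\<^esub> frac x \<one>"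
    using L.divides_trans[OF L.divides_trans[OF 3 1] 2] L.nat_pow_closed[OF pc] by simp
  then show ?thesis
    using L.dvr_valuation_ge_iff[OF p fc(2), of k] x frac_eq_zero_iff by (simp add: val_at_def)
qed

end

text \<open>The elements \<open>x\<close> with \<open>c\<close> dividing
  \<open>s \<otimes> x\<close> form the colon ideal of the principal ideal of \<open>c\<close> by
  \<open>s\<close>. It contains \<open>A\<close>, hence also the ideal generated by
  \<open>A\<close>.\<close>

lemma (in cring) genideal_multiplier:
  assumes A: "A \<subseteq> carrier R" and c: "c \<in> carrier R" and s: "s \<in> carrier R"
    and dvd: "\<And>x. x \<in> A \<Longrightarrow> c divides s \<otimes> x" and y: "y \<in> Idl A"
  shows "c divides s \<otimes> y"
proof -
  let ?J = "{x \<in> carrier R. c divides s \<otimes> x}"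
  have mult: "c divides s \<otimes> (u \<otimes> v)" if sv: "c divides s \<otimes> v" and uv: "u \<in> carrier R" "v \<in> carrier R" for u v
  proof -
    obtain d where "d \<in> carrier R" "s \<otimes> v = c \<otimes> d"
      using sv by (auto simp: factor_def)
    then have "s \<otimes> (u \<otimes> v) = c \<otimes> (u \<otimes> d)"
      using uv c s m_lcomm[of s u v] m_lcomm[of u c d] by simp
    then show ?thesis
      using \<open>d \<in> carrier R\<close> uv(1) by (auto simp: factor_def)
  qed
  have "ideal ?J R"
  proof (rule idealI[OF ring_axioms])
    show "subgroup ?J (add_monoid R)"
    proof (rule add.subgroupI)
      have "\<zero> \<in> ?J" using divides_zero[OF c] s by simp
      then show "?J \<noteq> {}" by blast
    next
      fix x assume "x \<in> ?J"
      then obtain d where "x \<in> carrier R" "d \<in> carrier R" "s \<otimes> x = c \<otimes> d"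
        by (auto simp: factor_def)
      then have "s \<otimes> (\<ominus> x) = c \<otimes> (\<ominus> d)" using c s by (simp add: r_minus)
      then show "\<ominus> x \<in> ?J" using \<open>x \<in> carrier R\<close> \<open>d \<in> carrier R\<close> by (auto simp: factor_def)
    next
      fix x y assume "x \<in> ?J" "y \<in> ?J"
      then obtain d e where "x \<in> carrier R" "y \<in> carrier R" "d \<in> carrier R" "e \<in> carrier R"
        "s \<otimes> x = c \<otimes> d" "s \<otimes> y = c \<otimes> e"
        by (auto simp: factor_def)
      then have "s \<otimes> (x \<oplus> y) = c \<otimes> (d \<oplus> e)" using c s by (simp add: r_distr)
      then show "x \<oplus> y \<in> ?J"
        using \<open>x \<in> carrier R\<close> \<open>y \<in> carrier R\<close> \<open>d \<in> carrier R\<close> \<open>e \<in> carrier R\<close>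
        by (auto simp: factor_def)
    qed auto
  qed (use mult m_comm in auto)
  moreover have "A \<subseteq> ?J" using A dvd by auto
  ultimately show ?thesis using genideal_minimal y by blast
qed

section \<open>Lower semicontinuity\<close>

text \<open>The integer infimum is meaningful only for nonempty sets bounded below. The bound 0
  holds for any \<open>D\<close> and \<open>M\<close>, since \<open>dvr_valuation\<close> is the
  image of a natural number.\<close>

lemma ideal_val_ge_iff:
  assumes "I - {\<zero>\<^bsub>D\<^esub>} \<noteq> {}"
  shows "c \<le> ideal_val D I M \<longleftrightarrow> (\<forall>x\<in>I - {\<zero>\<^bsub>D\<^esub>}. c \<le> val_at D M x)"
proof -
  have "bdd_below (val_at D M ` (I - {\<zero>\<^bsub>D\<^esub>}))"
    by (rule bdd_belowI[of _ 0]) (auto simp: val_at_def dvr_valuation_def)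
  then show ?thesis
    using assms by (simp add: ideal_val_def le_cINF_iff)
qed

lemma openin_constructible:
  assumes "finitely_generated_ideal D J"
  shows "openin (constructible_topology D) {M \<in> Max_spec D. J \<subseteq> M}"
    and "openin (constructible_topology D) {M \<in> Max_spec D. \<not> J \<subseteq> M}"
  using assms unfolding constructible_topology_def
  by (intro topology_generated_by_Basis; blast)+

text \<open>The zero ideal is finitely generated and lies in every maximal ideal, so one generating
  set is already all of \<open>Max_spec D\<close>.\<close>

lemma topspace_constructible:
  assumes "ring D"
  shows "topspace (constructible_topology D) = Max_spec D"
proof
  show "topspace (constructible_topology D) \<subseteq> Max_spec D"
    by (auto simp: constructible_topology_def)
  interpret ring D by fact
  have "finitely_generated_ideal D {\<zero>\<^bsub>D\<^esub>}"
    unfolding finitely_generated_ideal_def using genideal_zero by (intro exI[of _ "{\<zero>\<^bsub>D\<^esub>}"]) simp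
  moreover have "Max_spec D = {M \<in> Max_spec D. {\<zero>\<^bsub>D\<^esub>} \<subseteq> M}"
    by (auto simp: Max_spec_def maximalideal_def ideal_def additive_subgroup.zero_closed)
  ultimately show "Max_spec D \<subseteq> topspace (constructible_topology D)"
    using openin_subset[OF openin_constructible(1)] by fastforce
qed

text \<open>
  If \<open>v\<^sub>M(I) \<ge> k\<close>, choose \<open>a \<in> M\<close> with \<open>v\<^sub>M(a) = 1\<close>. As \<open>I\<close> is finitely generated and
  \<open>I D\<^sub>M \<subseteq> a\<^sup>k D\<^sub>M\<close>, there is \<open>s \<notin> M\<close> with \<open>s I \<subseteq> a\<^sup>k D\<close>. Every maximal ideal \<open>N\<close> with
  \<open>a \<in> N\<close> and \<open>s \<notin> N\<close> then satisfies \<open>v\<^sub>N(I) \<ge> k v\<^sub>N(a) \<ge> k\<close>.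
\<close>

lemma openin_ideal_val_ge:
  assumes D: "almost_dedekind_domain D" and "ideal I D"
    and fg: "finitely_generated_ideal D I" and "I \<noteq> {\<zero>\<^bsub>D\<^esub>}"
  shows "openin (constructible_topology D) {M \<in> Max_spec D. int k \<le> ideal_val D I M}"
proof (subst openin_subopen, intro ballI)
  interpret domain D using D by (simp add: almost_dedekind_domain_def)
  interpret I: ideal I D by fact
  have ne: "I - {\<zero>\<^bsub>D\<^esub>} \<noteq> {}"
    using \<open>I \<noteq> {\<zero>\<^bsub>D\<^esub>}\<close> I.zero_closed by blast
  have loc: "dvr_localized_domain D N" if "N \<in> Max_spec D" for N
    using that D domain_axioms
    unfolding almost_dedekind_domain_def Max_spec_def dvr_localized_domain_def
      dvr_localized_domain_axioms_def localized_domain_def localized_domain_axioms_def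
    by blast
  have fgP: "finitely_generated_ideal D (Idl\<^bsub>D\<^esub> {x})" if "x \<in> carrier D" for x
    using that unfolding finitely_generated_ideal_def by blast
  have subset_iff: "Idl\<^bsub>D\<^esub> {x} \<subseteq> N \<longleftrightarrow> x \<in> N" if "x \<in> carrier D" "N \<in> Max_spec D" for x N
    using that Idl_subset_ideal'[of x] genideal_self'[of x] genideal_minimal[of N "{x}"]
    by (auto simp: Max_spec_def maximalideal_def)
  obtain A where A: "finite A" "A \<subseteq> carrier D" "I = Idl\<^bsub>D\<^esub> A"
    using fg by (auto simp: finitely_generated_ideal_def)
  fix M assume "M \<in> {M \<in> Max_spec D. int k \<le> ideal_val D I M}"
  then have M: "M \<in> Max_spec D" and val: "int k \<le> ideal_val D I M" by auto
  interpret M: dvr_localized_domain D M using loc M by blast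
  obtain a where a: "a \<in> M" "uniformizer M.L (M.frac a \<one>\<^bsub>D\<^esub>)"
    using M.frac_uniformizer_exists by blast
  have ac: "a \<in> carrier D" using a(1) by (rule M.M.Icarr)
  have "\<exists>s\<in>M.S. a [^]\<^bsub>D\<^esub> k divides\<^bsub>D\<^esub> s \<otimes>\<^bsub>D\<^esub> x" if "x \<in> A" for x
  proof (cases "x = \<zero>\<^bsub>D\<^esub>")
    \<comment> \<open>A zero generator is treated apart, with multiplier 1: it is left out of the
      infimum and its \<open>val_at\<close> is unspecified.\<close>
    case True
    then have "a [^]\<^bsub>D\<^esub> k divides\<^bsub>D\<^esub> \<one>\<^bsub>D\<^esub> \<otimes>\<^bsub>D\<^esub> x"
      using ac divides_zero by simp
    then show ?thesis using M.one_mem_S by blast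
  next
    case False
    have "x \<in> I" using that A genideal_self by blast
    then have "int k \<le> val_at D M x"
      using val False ideal_val_ge_iff[OF ne] by blast
    then show ?thesis
      using M.val_at_ge_imp_divides[OF ac a(2)] that A(2) False by blast
  qed
  then obtain s where s: "s \<in> M.S" "\<forall>x\<in>A. a [^]\<^bsub>D\<^esub> k divides\<^bsub>D\<^esub> s \<otimes>\<^bsub>D\<^esub> x"
    using M.finite_common_multiplier[OF A(1,2), of "a [^]\<^bsub>D\<^esub> k"] ac by auto
  have sI: "a [^]\<^bsub>D\<^esub> k divides\<^bsub>D\<^esub> s \<otimes>\<^bsub>D\<^esub> x" if "x \<in> I" for x
    using genideal_multiplier[OF A(2), of "a [^]\<^bsub>D\<^esub> k" s x] s ac that A(3) by auto
  \<comment> \<open>Principal ideals express membership of \<open>a\<close> and non-membership of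
    \<open>s\<close>. Openness of the first set is what the constructible topology adds to the
    Zariski topology.\<close>
  define U where "U = {N \<in> Max_spec D. Idl\<^bsub>D\<^esub> {a} \<subseteq> N} \<inter> {N \<in> Max_spec D. \<not> Idl\<^bsub>D\<^esub> {s} \<subseteq> N}"
  have U: "N \<in> U \<longleftrightarrow> N \<in> Max_spec D \<and> a \<in> N \<and> s \<notin> N" for N
    using ac s(1) subset_iff by (auto simp: U_def)
  have "openin (constructible_topology D) U"
    unfolding U_def using ac s(1) fgP by (intro openin_Int openin_constructible) auto
  moreover have "M \<in> U"
    using M a(1) s(1) by (simp add: U)
  moreover have "int k \<le> ideal_val D I N" if N: "N \<in> U" for N
  proof -
    interpret N: dvr_localized_domain D N using loc N U by blast
    show ?thesis
      unfolding ideal_val_ge_iff[OF ne]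
    proof
      fix x assume "x \<in> I - {\<zero>\<^bsub>D\<^esub>}"
      then show "int k \<le> val_at D N x"
        using N.divides_imp_val_at_ge[of a s x k] sI N s(1) I.Icarr U by blast
    qed
  qed
  ultimately show "\<exists>T. openin (constructible_topology D) T \<and> M \<in> T \<and>
      T \<subseteq> {M \<in> Max_spec D. int k \<le> ideal_val D I M}"
    using U by (intro exI[of _ U] conjI subsetI) simp_all
qed

theorem proposition4p3:
  fixes D :: "('a, 'b) ring_scheme" and I :: "'a set"
  assumes "almost_dedekind_domain D"
    and "ideal I D"
    and "finitely_generated_ideal D I"
    and "I \<noteq> {\<zero>\<^bsub>D\<^esub>}"
    and "I \<noteq> carrier D"
  shows "lower_semicontinuous_map (constructible_topology D) (ideal_val D I) \<and>
    (\<forall>n::int. n \<ge> 0 \<longrightarrow>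
       closedin (constructible_topology D) {M \<in> Max_spec D. ideal_val D I M \<le> n} \<and>
       openin (constructible_topology D) {M \<in> Max_spec D. ideal_val D I M > n})"
proof -
  have top: "topspace (constructible_topology D) = Max_spec D"
    using assms(2) by (intro topspace_constructible) (simp add: ideal_def)
  have "I - {\<zero>\<^bsub>D\<^esub>} \<noteq> {}"
    using assms(2,4) additive_subgroup.zero_closed by (fastforce simp: ideal_def)
  then have nonneg: "0 \<le> ideal_val D I M" for M
    by (simp add: ideal_val_ge_iff val_at_def dvr_valuation_def)
  \<comment> \<open>Semicontinuity concerns every integer \<open>c\<close>. For negative
    \<open>c\<close>, \<open>nat (c + 1)\<close> is 0 and both conditions hold throughout by
    \<open>nonneg\<close>.\<close>
  have "{M \<in> Max_spec D. ideal_val D I M > c} = {M \<in> Max_spec D. int (nat (c + 1)) \<le> ideal_val D I M}"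
    for c
  proof (intro Collect_cong conj_cong refl)
    fix M
    show "c < ideal_val D I M \<longleftrightarrow> int (nat (c + 1)) \<le> ideal_val D I M"
      using nonneg[of M] by linarith
  qed
  then have "openin (constructible_topology D) {M \<in> Max_spec D. ideal_val D I M > c}" for c
    using openin_ideal_val_ge[OF assms(1-4), of "nat (c + 1)"] by metis
  moreover have "Max_spec D - {M \<in> Max_spec D. ideal_val D I M \<le> n} = {M \<in> Max_spec D. ideal_val D I M > n}"
    for n
    by auto
  ultimately show ?thesis
    by (auto simp: lower_semicontinuous_map_def top closedin_def)
qed

end
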